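(* Let $(a_k)_{k\ge1}$ be a sequence of scalars satisfying $\sup_n\frac1n\sum_{k=1}^n|a_k|=C<\infty$. If $|a_k|=o(k)$ as $k\to\infty$, then for every contraction $T$ on a (real or complex) Hilbert space $H$ and every $x\in H$ with $T^nx\to0$ weakly, we have $$\lim_{n\to\infty}\Big\|\frac1n\sum_{k=1}^n a_kT^kx\Big\|=0.$$
   Context: A contraction is a linear operator $T$ with $\|T\|\le1$. The scalars $a_k$ are complex, and real if $H$ is a real Hilbert space. *)

theory Defs
  imports "HOL-Analysis.Analysis" "HOL-Library.Landau_Symbols"
begin

class complex_normed_vector = real_normed_vector +
  fixes scaleC :: "complex \<Rightarrow> 'a \<Rightarrow> 'a"  (infixr \<open>*\<^sub>C\<close> 75)
  assumes scaleC_add_right: "c *\<^sub>C (x + y) = c *\<^sub>C x + c *\<^sub>C y"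
    and scaleC_add_left: "(c + d) *\<^sub>C x = c *\<^sub>C x + d *\<^sub>C x"
    and scaleC_scaleC: "c *\<^sub>C d *\<^sub>C x = (c * d) *\<^sub>C x"
    and scaleC_one: "1 *\<^sub>C x = x"
    and scaleR_scaleC: "r *\<^sub>R x = complex_of_real r *\<^sub>C x"
    and norm_scaleC: "norm (c *\<^sub>C x) = cmod c * norm x"

class complex_inner = complex_normed_vector +
  fixes cinner :: "'a \<Rightarrow> 'a \<Rightarrow> complex"
  assumes cinner_commute: "cinner x y = cnj (cinner y x)"
    and cinner_add_left: "cinner (x + y) z = cinner x z + cinner y z"
    and cinner_scaleC_left: "cinner (c *\<^sub>C x) y = c * cinner x y"
    and cinner_ge_zero: "0 \<le> Re (cinner x x)"
    and cinner_eq_zero_iff: "cinner x x = 0 \<longleftrightarrow> x = 0"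
    and norm_eq_sqrt_cinner: "norm x = sqrt (Re (cinner x x))"

class complex_hilbert_space = complex_inner + complete_space

instantiation complex :: complex_hilbert_space
begin

definition scaleC_complex :: "complex \<Rightarrow> complex \<Rightarrow> complex"
  where "scaleC_complex c z = c * z"

definition cinner_complex :: "complex \<Rightarrow> complex \<Rightarrow> complex"
  where "cinner_complex z w = z * cnj w"

instance
proof
  fix c d x y z :: complex and r :: real
  show "c *\<^sub>C (x + y) = c *\<^sub>C x + c *\<^sub>C y"
    by (simp add: scaleC_complex_def distrib_left)
  show "(c + d) *\<^sub>C x = c *\<^sub>C x + d *\<^sub>C x"
    by (simp add: scaleC_complex_def distrib_right)
  show "c *\<^sub>C d *\<^sub>C x = (c * d) *\<^sub>C x"
    by (simp add: scaleC_complex_def)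
  show "1 *\<^sub>C x = x"
    by (simp add: scaleC_complex_def)
  show "r *\<^sub>R x = complex_of_real r *\<^sub>C x"
    by (simp add: scaleC_complex_def scaleR_conv_of_real)
  show "norm (c *\<^sub>C x) = cmod c * norm x"
    by (simp add: scaleC_complex_def norm_mult)
  show "cinner x y = cnj (cinner y x)"
    by (simp add: cinner_complex_def)
  show "cinner (x + y) z = cinner x z + cinner y z"
    by (simp add: cinner_complex_def distrib_right)
  show "cinner (c *\<^sub>C x) y = c * cinner x y"
    by (simp add: cinner_complex_def scaleC_complex_def)
  show "0 \<le> Re (cinner x x)"
    by (simp add: cinner_complex_def)
  show "cinner x x = 0 \<longleftrightarrow> x = 0"
    by (simp add: cinner_complex_def)
  show "norm x = sqrt (Re (cinner x x))"
    by (simp add: cinner_complex_def cmod_def power2_eq_square)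
qed

end

definition bounded_clinear ::
    "('a::complex_normed_vector \<Rightarrow> 'b::complex_normed_vector) \<Rightarrow> bool"
  where "bounded_clinear f \<longleftrightarrow>
    bounded_linear f \<and> (\<forall>c x. f (c *\<^sub>C x) = c *\<^sub>C f x)"

definition contraction :: "('a::real_normed_vector \<Rightarrow> 'a) \<Rightarrow> bool"
  where "contraction T \<longleftrightarrow> bounded_linear T \<and> onorm T \<le> 1"

definition ccontraction :: "('a::complex_normed_vector \<Rightarrow> 'a) \<Rightarrow> bool"
  where "ccontraction T \<longleftrightarrow> bounded_clinear T \<and> onorm T \<le> 1"

definition weakly_converges :: "(nat \<Rightarrow> 'a::real_normed_vector) \<Rightarrow> 'a \<Rightarrow> bool"
  where "weakly_converges X l \<longleftrightarrow>
    (\<forall>f :: 'a \<Rightarrow> real. bounded_linear f \<longrightarrow> (\<lambda>n. f (X n)) \<longlonglongrightarrow> f l)"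

definition cweakly_converges :: "(nat \<Rightarrow> 'a::complex_normed_vector) \<Rightarrow> 'a \<Rightarrow> bool"
  where "cweakly_converges X l \<longleftrightarrow>
    (\<forall>f :: 'a \<Rightarrow> complex. bounded_clinear f \<longrightarrow> (\<lambda>n. f (X n)) \<longlonglongrightarrow> f l)"

end

theory Submission
  imports Defs
begin

text \<open>
  Write \<open>\<langle>u, v\<rangle>\<close> for the real inner product, and \<open>L\<close> for the limit of the decreasing sequence
  \<open>\<parallel>T^n x\<parallel>\<^sup>2\<close>. For each \<open>m\<close> the form \<open>\<langle>u, v\<rangle> - \<langle>T^m u, T^m v\<rangle>\<close> is positive semidefinite, so
  Cauchy-Schwarz for it, at \<open>u = T^(n+N) x\<close> and \<open>v = T^N x\<close>, bounds
  \<open>\<langle>T^(n+N) x, T^N x\<rangle> - \<langle>T^(n+N+m) x, T^(N+m) x\<rangle>\<close> by \<open>\<parallel>T^N x\<parallel>\<^sup>2 - L\<close>, uniformly in \<open>n\<close> and \<open>m\<close>.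
  With weak convergence this gives \<open>\<langle>T^(n+j) x, T^j x\<rangle> \<rightarrow> 0\<close> as \<open>n \<rightarrow> \<infinity>\<close>, uniformly in \<open>j\<close>.
  In the expansion of \<open>\<parallel>\<Sum> a\<^sub>k T^k x\<parallel>\<^sup>2\<close> the terms far from the diagonal are then controlled by
  the Cesaro bound, and those in a band of fixed width around it by \<open>max\<^sub>k\<^sub>\<le>\<^sub>n \<bar>a\<^sub>k\<bar> = o(n)\<close>.
  Complex scalars are split into real and imaginary parts.
\<close>

section \<open>Powers of a linear contraction\<close>

lemma linear_funpow:
  fixes T :: "'a::real_vector \<Rightarrow> 'a"
  assumes "linear T"
  shows "linear (T ^^ n)"
proof (induction n)
  case 0
  show ?case using linear_id by (simp add: id_def)
next
  case (Suc n)
  show ?case using linear_compose[OF Suc assms] by (simp add: o_def)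
qed

lemma norm_funpow_le:
  fixes T :: "'a::real_normed_vector \<Rightarrow> 'a"
  assumes "\<And>y. norm (T y) \<le> norm y"
  shows "norm ((T ^^ n) x) \<le> norm x"
  by (induction n) (simp_all add: order_trans[OF assms])

section \<open>Positive semidefinite real forms\<close>

text \<open>Only semidefiniteness is assumed, because the defect form of a contraction can vanish at
  nonzero vectors.\<close>

locale semidefinite_form =
  fixes B :: "'a::real_vector \<Rightarrow> 'a \<Rightarrow> real"
  assumes form_commute: "B x y = B y x"
    and form_add_left: "B (x + y) z = B x z + B y z"
    and form_scaleR_left: "B (r *\<^sub>R x) y = r * B x y"
    and form_nonneg: "0 \<le> B x x"
begin

lemma form_add_right: "B z (x + y) = B z x + B z y"
  by (metis form_commute form_add_left)

lemma form_scaleR_right: "B x (r *\<^sub>R y) = r * B x y"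
  by (metis form_commute form_scaleR_left)

lemma form_zero_left: "B 0 y = 0"
  using form_scaleR_left[of 0 0 y] by simp

lemma form_sum_left: "B (\<Sum>i\<in>I. f i) y = (\<Sum>i\<in>I. B (f i) y)"
  by (induction I rule: infinite_finite_induct) (simp_all add: form_zero_left form_add_left)

lemma form_sum_right: "B x (\<Sum>i\<in>I. f i) = (\<Sum>i\<in>I. B x (f i))"
  by (simp add: form_commute[of x] form_sum_left)

text \<open>The polynomial \<open>B (x + t *\<^sub>R y) (x + t *\<^sub>R y)\<close> in
  \<open>t\<close> is nonnegative. If \<open>B y y = 0\<close> it is affine, so its slope must
  vanish; otherwise its minimum gives the claim.\<close>

lemma Cauchy_Schwarz: "(B x y)\<^sup>2 \<le> B x x * B y y"
proof -
  have *: "0 \<le> B x x + 2 * t * B x y + t\<^sup>2 * B y y" for t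
    using form_nonneg[of "x + t *\<^sub>R y"] form_commute[of y x]
    by (simp add: form_add_left form_add_right form_scaleR_left form_scaleR_right
        power2_eq_square algebra_simps)
  show ?thesis
  proof (cases "B y y = 0")
    case True
    have "B x y = 0"
    proof (rule ccontr)
      assume "B x y \<noteq> 0"
      \<comment> \<open>At this \<open>t\<close> the affine polynomial takes the value -1.\<close>
      then show False
        using *[of "- (B x x + 1) / (2 * B x y)"] True
        by (simp add: field_simps)
    qed
    then show ?thesis using True by simp
  next
    case False
    then have "0 < B y y" using form_nonneg[of y] by simp
    \<comment> \<open>The instance of \<open>t\<close> is the minimizer of the polynomial.\<close>
    then show ?thesis
      using *[of "- B x y / B y y"] by (simp add: field_simps power2_eq_square)
  qed
qed

end

section \<open>Real forms inducing the norm, and correlations along an orbit\<close>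

text \<open>Covers both a real inner product and the real part of a complex one, so that the
  argument is carried out once, over the reals.\<close>

locale norm_form =
  fixes B :: "'a::real_normed_vector \<Rightarrow> 'a \<Rightarrow> real"
  assumes commute: "B x y = B y x"
    and add_left: "B (x + y) z = B x z + B y z"
    and scaleR_left: "B (r *\<^sub>R x) y = r * B x y"
    and form_same: "B x x = (norm x)\<^sup>2"
begin

sublocale semidefinite_form B
  by unfold_locales (rule commute add_left scaleR_left | simp add: form_same)+

lemma abs_form_le: "\<bar>B x y\<bar> \<le> norm x * norm y"
proof (rule power2_le_imp_le)
  show "\<bar>B x y\<bar>\<^sup>2 \<le> (norm x * norm y)\<^sup>2"
    using Cauchy_Schwarz[of x y] by (simp add: form_same power_mult_distrib)
qed simp

lemma contraction_defect_le:
  assumes "linear S" and "\<And>y. norm (S y) \<le> norm y"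
  shows "(B u v - B (S u) (S v))\<^sup>2
    \<le> ((norm u)\<^sup>2 - (norm (S u))\<^sup>2) * ((norm v)\<^sup>2 - (norm (S v))\<^sup>2)"
proof -
  interpret Q: semidefinite_form "\<lambda>x y. B x y - B (S x) (S y)"
  proof
    fix x y z :: 'a and r :: real
    show "B x y - B (S x) (S y) = B y x - B (S y) (S x)"
      by (metis commute)
    show "B (x + y) z - B (S (x + y)) (S z) = B x z - B (S x) (S z) + (B y z - B (S y) (S z))"
      by (simp add: linear_add[OF assms(1)] add_left)
    show "B (r *\<^sub>R x) y - B (S (r *\<^sub>R x)) (S y) = r * (B x y - B (S x) (S y))"
      by (simp add: linear_scale[OF assms(1)] scaleR_left right_diff_distrib)
    show "0 \<le> B x x - B (S x) (S x)"
      using assms(2)[of x] by (simp add: form_same power_mono)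
  qed
  show ?thesis
    using Q.Cauchy_Schwarz[of u v] by (simp add: form_same)
qed

text \<open>Weak convergence settles the finitely many \<open>j \<le> N\<close> together. Each
  larger \<open>j\<close> is compared with \<open>j = N\<close> through the defect bound, whose size
  depends only on \<open>N\<close>.\<close>

lemma correlations_uniformly_small:
  fixes T :: "'a \<Rightarrow> 'a"
  assumes lin: "linear T" and contr: "\<And>y. norm (T y) \<le> norm y"
    and weak: "\<And>y. (\<lambda>n. B ((T ^^ n) x) y) \<longlonglongrightarrow> 0"
    and "0 < e"
  obtains M where "\<And>n j. M \<le> n \<Longrightarrow> \<bar>B ((T ^^ (n + j)) x) ((T ^^ j) x)\<bar> \<le> e"
proof -
  define s where "s n = (norm ((T ^^ n) x))\<^sup>2" for n
  have "decseq s"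
    unfolding s_def by (rule decseq_SucI) (simp add: power_mono contr)
  then obtain L where "s \<longlonglongrightarrow> L"
    by (rule decseq_convergent[where B = 0]) (simp add: s_def)
  then have "Cauchy s"
    by (rule LIMSEQ_imp_Cauchy)
  then obtain N where N: "\<And>m n. N \<le> m \<Longrightarrow> N \<le> n \<Longrightarrow> \<bar>s m - s n\<bar> < e / 2"
    using \<open>0 < e\<close> by (metis CauchyD half_gt_zero real_norm_def)
  have "\<forall>\<^sub>F n in sequentially. \<forall>j\<in>{..N}. \<bar>B ((T ^^ (n + j)) x) ((T ^^ j) x)\<bar> < e / 2"
  proof (rule eventually_ball_finite)
    show "\<forall>j\<in>{..N}. \<forall>\<^sub>F n in sequentially. \<bar>B ((T ^^ (n + j)) x) ((T ^^ j) x)\<bar> < e / 2"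
    proof
      fix j
      have "(\<lambda>n. B ((T ^^ (n + j)) x) ((T ^^ j) x)) \<longlonglongrightarrow> 0"
        by (rule LIMSEQ_ignore_initial_segment[OF weak])
      from tendstoD[OF this half_gt_zero[OF \<open>0 < e\<close>]]
      show "\<forall>\<^sub>F n in sequentially. \<bar>B ((T ^^ (n + j)) x) ((T ^^ j) x)\<bar> < e / 2"
        by (simp add: dist_real_def)
    qed
  qed simp
  then obtain M where M: "\<And>n j. M \<le> n \<Longrightarrow> j \<le> N \<Longrightarrow>
      \<bar>B ((T ^^ (n + j)) x) ((T ^^ j) x)\<bar> < e / 2"
    by (auto simp: eventually_sequentially)
  show thesis
  proof (rule that[of M])
    fix n j
    assume "M \<le> n"
    show "\<bar>B ((T ^^ (n + j)) x) ((T ^^ j) x)\<bar> \<le> e"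
    proof (cases "j \<le> N")
      case True
      then show ?thesis using M[OF \<open>M \<le> n\<close> True] \<open>0 < e\<close> by simp
    next
      case False
      \<comment> \<open>\<open>T ^^ m\<close> carries the pair with indices \<open>n + N\<close>,
        \<open>N\<close> to the pair with indices \<open>n + j\<close>, \<open>j\<close>.\<close>
      define m where "m = j - N"
      have j: "j = m + N" "n + j = m + (n + N)" using False by (simp_all add: m_def)
      let ?u = "(T ^^ (n + N)) x" and ?v = "(T ^^ N) x"
      have shift: "(T ^^ m) ?u = (T ^^ (n + j)) x" "(T ^^ m) ?v = (T ^^ j) x"
        by (simp only: j(2) funpow_add o_apply, simp only: j(1) funpow_add o_apply)
      have "(B ?u ?v - B ((T ^^ (n + j)) x) ((T ^^ j) x))\<^sup>2 \<le> (s (n + N) - s (n + j)) * (s N - s j)"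
        using contraction_defect_le[OF linear_funpow[OF lin, of m] norm_funpow_le[OF contr],
            where u = ?u and v = ?v] shift
        by (simp add: s_def)
      \<comment> \<open>All four indices are at least \<open>N\<close>, so the Cauchy property
        bounds each factor, whatever \<open>n\<close> and \<open>j\<close> are.\<close>
      also have "\<dots> \<le> (e / 2) * (e / 2)"
      proof (rule mult_mono)
        show "s (n + N) - s (n + j) \<le> e / 2"
          using N[of "n + N" "n + j"] False by linarith
        show "s N - s j \<le> e / 2"
          using N[of N j] False by linarith
        show "0 \<le> s N - s j"
          using \<open>decseq s\<close> False by (simp add: decseq_def)
      qed (use \<open>0 < e\<close> in simp)
      finally have "\<bar>B ?u ?v - B ((T ^^ (n + j)) x) ((T ^^ j) x)\<bar> \<le> e / 2"
        using abs_le_square_iff[of _ "e / 2"] \<open>0 < e\<close> by (simp add: power2_eq_square)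
      with M[OF \<open>M \<le> n\<close> order_refl] show ?thesis by linarith
    qed
  qed
qed

section \<open>Weighted averages\<close>

text \<open>No operator enters here: a bounded sequence with uniformly decaying correlations
  suffices for the near- and off-diagonal estimates.\<close>

lemma weighted_averages_tendsto_0:
  fixes a :: "nat \<Rightarrow> real" and v :: "nat \<Rightarrow> 'a"
  assumes corr: "\<And>e. 0 < e \<Longrightarrow> \<exists>M. \<forall>n\<ge>M. \<forall>j. \<bar>B (v (n + j)) (v j)\<bar> \<le> e"
    and bound: "\<And>k. norm (v k) \<le> R"
    and cesaro: "\<And>n. (\<Sum>k=1..n. \<bar>a k\<bar>) \<le> C * real n"
    and small: "a \<in> o(\<lambda>k. real k)"
  shows "(\<lambda>n. norm ((1 / real n) *\<^sub>R (\<Sum>k=1..n. a k *\<^sub>R v k))) \<longlonglongrightarrow> 0"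
proof -
  have "0 \<le> R" using bound[of 0] norm_ge_zero order_trans by blast
  have "0 \<le> C" using cesaro[of 1] by simp
  have key: "\<forall>\<^sub>F n in sequentially.
      (norm (\<Sum>k=1..n. a k *\<^sub>R v k))\<^sup>2 \<le> e * (C\<^sup>2 + C * R\<^sup>2) * (real n)\<^sup>2" if "0 < e" for e
  proof -
    obtain M where M: "\<And>n j. M \<le> n \<Longrightarrow> \<bar>B (v (n + j)) (v j)\<bar> \<le> e"
      using corr[OF \<open>0 < e\<close>] by blast
    \<comment> \<open>A row meets the band of half-width \<open>M\<close> in at most
      \<open>2 * M + 1\<close> entries, so a band of entries of size \<open>d\<close> adds up to at
      most \<open>e\<close>.\<close>
    define d where "d = e / (2 * real M + 1)"
    have "0 < d" using \<open>0 < e\<close> by (simp add: d_def)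
    obtain K where K: "\<And>k. K \<le> k \<Longrightarrow> \<bar>a k\<bar> \<le> d * real k"
      using landau_o.smallD[OF small \<open>0 < d\<close>] by (auto simp: eventually_sequentially)
    \<comment> \<open>Makes \<open>d * real n\<close> dominate also the finitely many weights before
      \<open>K\<close>.\<close>
    have "\<forall>\<^sub>F n in sequentially. (\<Sum>k<K. \<bar>a k\<bar>) / d \<le> real n"
      using filterlim_real_sequentially by (simp add: filterlim_at_top)
    then show ?thesis
    proof eventually_elim
      case (elim n)
      have max: "\<bar>a k\<bar> \<le> d * real n" if "k \<le> n" for k
      proof (cases "k < K")
        case True
        have "\<bar>a k\<bar> \<le> (\<Sum>k<K. \<bar>a k\<bar>)"
          using True by (intro member_le_sum) auto
        also have "\<dots> \<le> d * real n"
          using elim \<open>0 < d\<close> by (simp add: field_simps)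
        finally show ?thesis .
      next
        case False
        then have "\<bar>a k\<bar> \<le> d * real k" using K by simp
        also have "\<dots> \<le> d * real n" using that \<open>0 < d\<close> by simp
        finally show ?thesis .
      qed
      \<comment> \<open>Truncated subtraction is harmless: for \<open>k < M\<close> the band just
        starts at 0.\<close>
      have far: "\<bar>B (v k) (v j)\<bar> \<le> e" if "j \<notin> {k - M..k + M}" for j k
      proof (cases "k \<le> j")
        case True
        moreover have "M \<le> j - k" using that True by auto
        ultimately show ?thesis
          using M[of "j - k" k] commute[of "v k" "v j"] by simp
      next
        case False
        moreover have "M \<le> k - j" using that False by auto
        ultimately show ?thesis
          using M[of "k - j" j] by simp
      qed
      have near: "\<bar>B (v k) (v j)\<bar> \<le> R\<^sup>2" for j k
        using order_trans[OF abs_form_le mult_mono[OF bound bound \<open>0 \<le> R\<close> norm_ge_zero]]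
        by (simp add: power2_eq_square)
      have row: "(\<Sum>j=1..n. \<bar>a j\<bar> * \<bar>B (v k) (v j)\<bar>) \<le> e * (C + R\<^sup>2) * real n" for k
      proof -
        \<comment> \<open>The term \<open>\<bar>a j\<bar> * e\<close> is kept inside the band too,
          so that it sums over the whole row and the Cesaro bound applies.\<close>
        have "(\<Sum>j=1..n. \<bar>a j\<bar> * \<bar>B (v k) (v j)\<bar>)
            \<le> (\<Sum>j=1..n. \<bar>a j\<bar> * e + (if j \<in> {k - M..k + M} then d * real n * R\<^sup>2 else 0))"
        proof (rule sum_mono)
          fix j
          assume j: "j \<in> {1..n}"
          show "\<bar>a j\<bar> * \<bar>B (v k) (v j)\<bar>
              \<le> \<bar>a j\<bar> * e + (if j \<in> {k - M..k + M} then d * real n * R\<^sup>2 else 0)"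
          proof (cases "j \<in> {k - M..k + M}")
            case True
            have "\<bar>a j\<bar> * \<bar>B (v k) (v j)\<bar> \<le> d * real n * R\<^sup>2"
              using max[of j] j near \<open>0 < d\<close> by (intro mult_mono) auto
            moreover have "0 \<le> \<bar>a j\<bar> * e" using \<open>0 < e\<close> by simp
            ultimately show ?thesis using True by simp
          next
            case False
            then show ?thesis
              using far[OF False] by (simp only: if_False add_0_right mult_left_mono abs_ge_zero)
          qed
        qed
        also have "\<dots> = (\<Sum>j=1..n. \<bar>a j\<bar>) * e
            + real (card ({1..n} \<inter> {k - M..k + M})) * (d * real n * R\<^sup>2)"
          by (simp only: sum.distrib sum_distrib_right[symmetric] sum.inter_restrict[symmetric]
              finite_atLeastAtMost sum_constant)
        also have "\<dots> \<le> C * real n * e + (2 * real M + 1) * (d * real n * R\<^sup>2)"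
        proof -
          have "card ({1..n} \<inter> {k - M..k + M}) \<le> card {k - M..k + M}"
            by (intro card_mono) auto
          then have "real (card ({1..n} \<inter> {k - M..k + M})) \<le> 2 * real M + 1"
            unfolding card_atLeastAtMost by linarith
          then show ?thesis
            using cesaro[of n] \<open>0 < e\<close> \<open>0 < d\<close> by (intro add_mono mult_right_mono) auto
        qed
        also have "\<dots> = e * (C + R\<^sup>2) * real n"
        proof -
          have "(2 * real M + 1) * d = e" by (simp add: d_def)
          then have "(2 * real M + 1) * (d * real n * R\<^sup>2) = e * real n * R\<^sup>2"
            by (simp only: mult.assoc[symmetric])
          then show ?thesis by (simp add: algebra_simps)
        qed
        finally show ?thesis .
      qed
      have "(norm (\<Sum>k=1..n. a k *\<^sub>R v k))\<^sup>2 = (\<Sum>k=1..n. \<Sum>j=1..n. a k * (a j * B (v k) (v j)))"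
        by (simp only: form_same[symmetric] form_sum_left form_sum_right form_scaleR_left
            form_scaleR_right sum_distrib_left form_commute mult.left_commute)
      also have "\<dots> \<le> (\<Sum>k=1..n. \<Sum>j=1..n. \<bar>a k\<bar> * (\<bar>a j\<bar> * \<bar>B (v k) (v j)\<bar>))"
        by (intro sum_mono) (metis abs_ge_self abs_mult)
      also have "\<dots> = (\<Sum>k=1..n. \<bar>a k\<bar> * (\<Sum>j=1..n. \<bar>a j\<bar> * \<bar>B (v k) (v j)\<bar>))"
        by (simp add: sum_distrib_left)
      also have "\<dots> \<le> (\<Sum>k=1..n. \<bar>a k\<bar> * (e * (C + R\<^sup>2) * real n))"
        by (intro sum_mono mult_left_mono row) auto
      also have "\<dots> = (\<Sum>k=1..n. \<bar>a k\<bar>) * (e * (C + R\<^sup>2) * real n)"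
        by (simp add: sum_distrib_right)
      also have "\<dots> \<le> C * real n * (e * (C + R\<^sup>2) * real n)"
        using \<open>0 < e\<close> \<open>0 \<le> C\<close> by (intro mult_right_mono cesaro) auto
      also have "\<dots> = e * (C\<^sup>2 + C * R\<^sup>2) * (real n)\<^sup>2"
        by (simp add: power2_eq_square algebra_simps)
      finally show ?case .
    qed
  qed
  show ?thesis
  proof (rule tendstoI)
    fix r :: real
    assume "0 < r"
    \<comment> \<open>The added 1 keeps the denominator positive and makes the resulting inequality
      strict.\<close>
    define e where "e = r\<^sup>2 / (C\<^sup>2 + C * R\<^sup>2 + 1)"
    have pos: "0 < C\<^sup>2 + C * R\<^sup>2 + 1"
      using \<open>0 \<le> C\<close> by (intro add_nonneg_pos add_nonneg_nonneg) auto
    then have "0 < e" using \<open>0 < r\<close> by (simp add: e_def)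
    have "e * (C\<^sup>2 + C * R\<^sup>2) < e * (C\<^sup>2 + C * R\<^sup>2 + 1)"
      using \<open>0 < e\<close> by simp
    also have "\<dots> = r\<^sup>2" using pos by (simp add: e_def)
    finally have less: "e * (C\<^sup>2 + C * R\<^sup>2) < r\<^sup>2" .
    from key[OF \<open>0 < e\<close>] eventually_gt_at_top[of 0]
    show "\<forall>\<^sub>F n in sequentially.
        dist (norm ((1 / real n) *\<^sub>R (\<Sum>k=1..n. a k *\<^sub>R v k))) 0 < r"
    proof eventually_elim
      case (elim n)
      have "(norm (\<Sum>k=1..n. a k *\<^sub>R v k))\<^sup>2 < r\<^sup>2 * (real n)\<^sup>2"
        using elim less by (intro le_less_trans[OF elim(1)] mult_strict_right_mono) auto
      then have "norm (\<Sum>k=1..n. a k *\<^sub>R v k) < r * real n"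
        using \<open>0 < r\<close> by (intro power2_less_imp_less[of _ "r * real n"])
          (auto simp: power_mult_distrib)
      then show ?case
        using elim by (simp add: field_simps)
    qed
  qed
qed

lemma weighted_contraction_averages_tendsto_0:
  fixes a :: "nat \<Rightarrow> real" and T :: "'a \<Rightarrow> 'a"
  assumes "linear T" and contr: "\<And>y. norm (T y) \<le> norm y"
    and "\<And>y. (\<lambda>n. B ((T ^^ n) x) y) \<longlonglongrightarrow> 0"
    and "\<And>n. (\<Sum>k=1..n. \<bar>a k\<bar>) \<le> C * real n"
    and "a \<in> o(\<lambda>k. real k)"
  shows "(\<lambda>n. norm ((1 / real n) *\<^sub>R (\<Sum>k=1..n. a k *\<^sub>R (T ^^ k) x))) \<longlonglongrightarrow> 0"
proof (rule weighted_averages_tendsto_0)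
  show "\<exists>M. \<forall>n\<ge>M. \<forall>j. \<bar>B ((T ^^ (n + j)) x) ((T ^^ j) x)\<bar> \<le> e" if "0 < e" for e
    using correlations_uniformly_small[OF assms(1-3) that] by metis
  show "norm ((T ^^ k) x) \<le> norm x" for k
    by (rule norm_funpow_le[OF contr])
  show "(\<Sum>k=1..n. \<bar>a k\<bar>) \<le> C * real n" for n
    by (rule assms)
  show "a \<in> o(\<lambda>k. real k)"
    by (rule assms)
qed

end

section \<open>The real and complex inner products as instances\<close>

interpretation real_inner: norm_form "inner :: 'a::real_inner \<Rightarrow> 'a \<Rightarrow> real"
  by unfold_locales
    (rule inner_commute inner_add_left inner_scaleR_left | simp add: dot_square_norm)+

interpretation complex_inner: norm_form "\<lambda>x y::'a::complex_inner. Re (cinner x y)"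
proof
  fix x y z :: 'a and r :: real
  show "Re (cinner x y) = Re (cinner y x)"
    by (metis cinner_commute cnj.sel(1))
  show "Re (cinner (x + y) z) = Re (cinner x z) + Re (cinner y z)"
    by (simp add: cinner_add_left)
  show "Re (cinner (r *\<^sub>R x) y) = r * Re (cinner x y)"
    by (simp add: scaleR_scaleC cinner_scaleC_left)
  show "Re (cinner x x) = (norm x)\<^sup>2"
    by (simp add: norm_eq_sqrt_cinner cinner_ge_zero)
qed

text \<open>Makes weak convergence applicable to inner products. The crude factor 2 comes from
  bounding real and imaginary parts separately.\<close>

lemma bounded_clinear_cinner_left: "bounded_clinear (\<lambda>x::'a::complex_inner. cinner x y)"
proof -
  have "norm (cinner x y) \<le> norm x * (2 * norm y)" for x :: 'a
  proof -
    have "\<bar>Re (cinner x y)\<bar> \<le> norm x * norm y"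
      by (rule complex_inner.abs_form_le)
    moreover have "\<bar>Im (cinner x y)\<bar> \<le> norm x * norm y"
      \<comment> \<open>Multiplying by \<open>\<i>\<close> turns the imaginary part, up to sign,
        into a real part.\<close>
      using complex_inner.abs_form_le[of "\<i> *\<^sub>C x" y] by (simp add: cinner_scaleC_left norm_scaleC)
    ultimately show ?thesis
      using cmod_le[of "cinner x y"] by simp
  qed
  then have "bounded_linear (\<lambda>x. cinner x y)"
    by (intro bounded_linear_intro[where K = "2 * norm y"])
      (simp_all add: cinner_add_left scaleR_scaleC cinner_scaleC_left scaleR_conv_of_real
        scaleC_complex_def)
  then show ?thesis
    by (simp add: bounded_clinear_def cinner_scaleC_left scaleC_complex_def)
qed

section \<open>Reduction of the two scalar cases to the averages over a form\<close>

text \<open>Clearing the denominator lets the bound include \<open>n = 0\<close>, where both sides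
  vanish.\<close>

lemma sum_norm_le_of_SUP_averages:
  fixes a :: "nat \<Rightarrow> 'b::real_normed_vector"
  assumes "(SUP n\<in>{1..}. ereal (1 / real n * (\<Sum>k=1..n. norm (a k)))) < \<infinity>"
  shows "\<exists>C. \<forall>n. (\<Sum>k=1..n. norm (a k)) \<le> C * real n"
proof -
  obtain C where "(SUP n\<in>{1..}. ereal (1 / real n * (\<Sum>k=1..n. norm (a k)))) \<le> ereal C"
    using assms by (auto simp: less_PInf_Ex_of_nat dest!: less_imp_le)
  then have C: "1 / real n * (\<Sum>k=1..n. norm (a k)) \<le> C" if "1 \<le> n" for n
    using that by (simp add: SUP_le_iff)
  have "(\<Sum>k=1..n. norm (a k)) \<le> C * real n" for n
  proof (cases "n = 0")
    case False
    then show ?thesis using C[of n] by (simp add: field_simps)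
  qed simp
  then show ?thesis by blast
qed

lemma norm_le_of_onorm_le_1:
  assumes "bounded_linear T" and "onorm T \<le> 1"
  shows "norm (T y) \<le> norm y"
  using onorm[OF assms(1), of y] mult_right_mono[OF assms(2) norm_ge_zero[of y]] by simp

lemma real_weighted_averages_tendsto_0:
  fixes a :: "nat \<Rightarrow> real" and T :: "'r::real_inner \<Rightarrow> 'r"
  assumes bound: "(SUP n\<in>{1..}. ereal (1 / real n * (\<Sum>k=1..n. norm (a k)))) < \<infinity>"
    and small: "(\<lambda>k. norm (a k)) \<in> o(\<lambda>k. real k)"
    and T: "contraction T"
    and weak: "weakly_converges (\<lambda>n. (T ^^ n) x) 0"
  shows "(\<lambda>n. norm ((1 / real n) *\<^sub>R (\<Sum>k=1..n. a k *\<^sub>R (T ^^ k) x))) \<longlonglongrightarrow> 0"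
proof -
  obtain C where C: "\<And>n. (\<Sum>k=1..n. norm (a k)) \<le> C * real n"
    using sum_norm_le_of_SUP_averages[OF bound] by blast
  show ?thesis
  proof (rule real_inner.weighted_contraction_averages_tendsto_0)
    show "linear T"
      using T by (simp add: contraction_def bounded_linear.linear)
    show "norm (T y) \<le> norm y" for y
      using T by (simp add: contraction_def norm_le_of_onorm_le_1)
    show "(\<lambda>n. (T ^^ n) x \<bullet> y) \<longlonglongrightarrow> 0" for y
      using weak bounded_linear_inner_left[of y] by (force simp: weakly_converges_def)
    show "(\<Sum>k=1..n. \<bar>a k\<bar>) \<le> C * real n" for n
      using C by simp
    show "a \<in> o(\<lambda>k. real k)"
      using small by simp
  qed
qed

text \<open>Real and imaginary parts of the weights are dominated by their moduli, so each inherits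
  the Cesaro bound and the \<open>o(k)\<close> growth; the triangle inequality recombines
  them.\<close>

lemma complex_weighted_averages_tendsto_0:
  fixes a :: "nat \<Rightarrow> complex" and T :: "'c::complex_inner \<Rightarrow> 'c"
  assumes bound: "(SUP n\<in>{1..}. ereal (1 / real n * (\<Sum>k=1..n. norm (a k)))) < \<infinity>"
    and small: "(\<lambda>k. norm (a k)) \<in> o(\<lambda>k. real k)"
    and T: "ccontraction T"
    and weak: "cweakly_converges (\<lambda>n. (T ^^ n) x) 0"
  shows "(\<lambda>n. norm ((1 / real n) *\<^sub>R (\<Sum>k=1..n. a k *\<^sub>C (T ^^ k) x))) \<longlonglongrightarrow> 0"
proof -
  obtain C where C: "\<And>n. (\<Sum>k=1..n. norm (a k)) \<le> C * real n"
    using sum_norm_le_of_SUP_averages[OF bound] by blast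
  have lim: "(\<lambda>n. norm ((1 / real n) *\<^sub>R (\<Sum>k=1..n. b k *\<^sub>R (T ^^ k) x))) \<longlonglongrightarrow> 0"
    if b: "\<And>k. \<bar>b k\<bar> \<le> norm (a k)" for b
  proof (rule complex_inner.weighted_contraction_averages_tendsto_0)
    show "linear T"
      using T by (simp add: ccontraction_def bounded_clinear_def bounded_linear.linear)
    show "norm (T y) \<le> norm y" for y
      using T by (simp add: ccontraction_def bounded_clinear_def norm_le_of_onorm_le_1)
    show "(\<lambda>n. Re (cinner ((T ^^ n) x) y)) \<longlonglongrightarrow> 0" for y
    proof -
      have "(\<lambda>n. cinner ((T ^^ n) x) y) \<longlonglongrightarrow> cinner 0 y"
        by (rule weak[unfolded cweakly_converges_def, rule_format,
              OF bounded_clinear_cinner_left])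
      from tendsto_Re[OF this] show ?thesis
        by (simp add: complex_inner.form_zero_left)
    qed
    show "(\<Sum>k=1..n. \<bar>b k\<bar>) \<le> C * real n" for n
      by (rule order_trans[OF sum_mono C]) (rule b)
    have "b \<in> O(\<lambda>k. norm (a k))"
      using b by (intro bigoI[where c = 1]) simp
    then show "b \<in> o(\<lambda>k. real k)"
      using small by (rule landau_o.big_small_trans)
  qed
  have split: "a k *\<^sub>C y = Re (a k) *\<^sub>R y + \<i> *\<^sub>C (Im (a k) *\<^sub>R y)" for k and y :: 'c
    by (metis complex_eq scaleC_add_left scaleC_scaleC scaleR_scaleC)
  have sum_scaleC: "(\<Sum>k\<in>I. \<i> *\<^sub>C f k) = \<i> *\<^sub>C (\<Sum>k\<in>I. f k)" for I and f :: "nat \<Rightarrow> 'c"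
  proof -
    \<comment> \<open>Real linearity is enough to pull \<open>\<i>\<close> out of a finite
      sum.\<close>
    have "linear (\<lambda>y::'c. \<i> *\<^sub>C y)"
      by (rule linearI) (simp_all add: scaleC_add_right scaleR_scaleC scaleC_scaleC mult.commute)
    then show ?thesis by (simp add: linear_sum)
  qed
  show ?thesis
  proof (rule Lim_null_comparison[OF always_eventually])
    show "\<forall>n. norm (norm ((1 / real n) *\<^sub>R (\<Sum>k=1..n. a k *\<^sub>C (T ^^ k) x)))
        \<le> norm ((1 / real n) *\<^sub>R (\<Sum>k=1..n. Re (a k) *\<^sub>R (T ^^ k) x))
          + norm ((1 / real n) *\<^sub>R (\<Sum>k=1..n. Im (a k) *\<^sub>R (T ^^ k) x))"
    proof
      fix n
      let ?p = "\<Sum>k=1..n. Re (a k) *\<^sub>R (T ^^ k) x" and ?q = "\<Sum>k=1..n. Im (a k) *\<^sub>R (T ^^ k) x"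
      have "(\<Sum>k=1..n. a k *\<^sub>C (T ^^ k) x) = ?p + \<i> *\<^sub>C ?q"
        by (simp add: split sum.distrib sum_scaleC)
      moreover have "norm (?p + \<i> *\<^sub>C ?q) \<le> norm ?p + norm ?q"
        using norm_triangle_ineq[of ?p "\<i> *\<^sub>C ?q"] by (simp add: norm_scaleC)
      ultimately show "norm (norm ((1 / real n) *\<^sub>R (\<Sum>k=1..n. a k *\<^sub>C (T ^^ k) x)))
          \<le> norm ((1 / real n) *\<^sub>R ?p) + norm ((1 / real n) *\<^sub>R ?q)"
        by (simp add: divide_right_mono flip: add_divide_distrib)
    qed
    show "(\<lambda>n. norm ((1 / real n) *\<^sub>R (\<Sum>k=1..n. Re (a k) *\<^sub>R (T ^^ k) x))
          + norm ((1 / real n) *\<^sub>R (\<Sum>k=1..n. Im (a k) *\<^sub>R (T ^^ k) x))) \<longlonglongrightarrow> 0"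
      using tendsto_add[OF lim[of "\<lambda>k. Re (a k)"] lim[of "\<lambda>k. Im (a k)"]]
      by (simp add: abs_Re_le_cmod abs_Im_le_cmod)
  qed
qed

theorem proposition3p1:
  shows
    "(\<forall>(a :: nat \<Rightarrow> real) (C :: ereal).
        (SUP n\<in>{1..}. ereal (1 / real n * (\<Sum>k=1..n. norm (a k)))) = C \<and> C < \<infinity> \<longrightarrow>
        (\<lambda>k. norm (a k)) \<in> o(\<lambda>k. real k) \<longrightarrow>
        (\<forall>(T :: 'r::{real_inner, complete_space} \<Rightarrow> 'r) x.
          contraction T \<longrightarrow> weakly_converges (\<lambda>n. (T ^^ n) x) 0 \<longrightarrow>
          (\<lambda>n. norm ((1 / real n) *\<^sub>R (\<Sum>k=1..n. a k *\<^sub>R (T ^^ k) x))) \<longlonglongrightarrow> 0))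
     \<and>
     (\<forall>(a :: nat \<Rightarrow> complex) (C :: ereal).
        (SUP n\<in>{1..}. ereal (1 / real n * (\<Sum>k=1..n. norm (a k)))) = C \<and> C < \<infinity> \<longrightarrow>
        (\<lambda>k. norm (a k)) \<in> o(\<lambda>k. real k) \<longrightarrow>
        (\<forall>(T :: 'c::complex_hilbert_space \<Rightarrow> 'c) x.
          ccontraction T \<longrightarrow> cweakly_converges (\<lambda>n. (T ^^ n) x) 0 \<longrightarrow>
          (\<lambda>n. norm ((1 / real n) *\<^sub>R (\<Sum>k=1..n. a k *\<^sub>C (T ^^ k) x))) \<longlonglongrightarrow> 0))"
  using real_weighted_averages_tendsto_0 complex_weighted_averages_tendsto_0 by blast

end
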